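(* Let $Q\subseteq\mathbb{R}^n$ be a convex closed set, let $\mu>0$, let $f:Q\to\mathbb{R}$ be a $\mu$-strongly convex function, and let $x_*\in Q$ be the exact solution of $f(x)\to\min_{x\in Q}$. Let $x_1\in Q$ and, for $k\ge1$, $$x_{k+1}:=Pr_Q\{x_k-h_k\nabla f(x_k)\},\qquad h_k=\frac{2}{\mu(k+1)}.$$ Then after $N\ge1$ iterations of this algorithm $$f(\widehat x)-f(x_* )\le\frac{2}{\mu N(N+1)}\sum_{k=1}^{N}\frac{k\,\|\nabla f(x_k)\|_2^2}{k+1},\qquad\text{where}\qquad\widehat x=\sum_{k=1}^{N}\frac{2k}{N(N+1)}\,x_k.$$ If, moreover, $f$ is $M$-Lipschitz for some $M>0$, then for every $\varepsilon>0$ one has $f(\widehat x)-f(x)\le\varepsilon$ for every $x\in Q$ after $N=O\!\left(\frac{M^2}{\mu\varepsilon}\right)$ iterations; that is, there is an absolute constant $C>0$ such that this inequality holds for all integers $N\ge1$ with $N\ge C\frac{M^2}{\mu\varepsilon}$.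
   Context: $\|\cdot\|_2$ is the Euclidean norm, $Pr_Q$ is the Euclidean projection onto $Q$. $\nabla f(x)$ is an arbitrary subgradient of $f$ at $x$ (assumed to exist; in the $M$-Lipschitz case the subgradients used satisfy $\|\nabla f(x_k)\|_2\le M$). $f$ is $\mu$-strongly convex in the sense that $f(y)\ge f(x)+\langle\nabla f(x),y-x\rangle+\frac{\mu}{2}\|y-x\|_2^2$ for all $x,y\in Q$ and every subgradient $\nabla f(x)$. $f$ is $M$-Lipschitz if $|f(x)-f(y)|\le M\|x-y\|_2$ for all $x,y\in Q$. *)

theory Defs
  imports "HOL-Analysis.Analysis"
begin

text \<open>
  The constant in the rate \<open>O(M\<^sup>2/(\<mu>\<epsilon>))\<close> is absolute, in particular independent of the dimension,
  so the dimension has to be quantified inside the formula, under the existential quantifier for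
  the constant. A type-indexed space such as \<open>real ^ 'n\<close> does not allow this. All the
  spaces \<open>\<real>\<^sup>n\<close> are therefore realised inside one inner product space, the finitely supported real
  sequences, as the subspaces \<open>Rn n\<close> of sequences supported in \<open>{..<n}\<close>. A subset of \<open>Rn n\<close> is
  closed in \<open>Rn n\<close> iff it is closed in the ambient space.
\<close>

typedef fseq = "{a :: nat \<Rightarrow> real. finite {i. a i \<noteq> 0}}"
  morphisms coord Abs_fseq
  by (rule exI[of _ "\<lambda>_. 0"]) simp

setup_lifting type_definition_fseq

lemma finite_support: "finite {i. coord x i \<noteq> 0}"
  using coord[of x] by simp

lemma fseq_eqI: "(\<And>i. coord x i = coord y i) \<Longrightarrow> x = y"
  by (metis coord_inject ext)

instantiation fseq :: real_vector
begin

lift_definition zero_fseq :: fseq is "\<lambda>_. 0"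
  by simp

lift_definition plus_fseq :: "fseq \<Rightarrow> fseq \<Rightarrow> fseq" is "\<lambda>a b i. a i + b i"
  subgoal for a b
    by (rule finite_subset[of _ "{i. a i \<noteq> 0} \<union> {i. b i \<noteq> 0}"]) auto
  done

lift_definition minus_fseq :: "fseq \<Rightarrow> fseq \<Rightarrow> fseq" is "\<lambda>a b i. a i - b i"
  subgoal for a b
    by (rule finite_subset[of _ "{i. a i \<noteq> 0} \<union> {i. b i \<noteq> 0}"]) auto
  done

lift_definition uminus_fseq :: "fseq \<Rightarrow> fseq" is "\<lambda>a i. - a i"
  by simp

lift_definition scaleR_fseq :: "real \<Rightarrow> fseq \<Rightarrow> fseq" is "\<lambda>r a i. r * a i"
  by simp

instance
  by standard (transfer; simp add: algebra_simps fun_eq_iff)+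

end

lemma coord_simps [simp]:
  "coord 0 i = 0"
  "coord (x + y) i = coord x i + coord y i"
  "coord (x - y) i = coord x i - coord y i"
  "coord (- x) i = - coord x i"
  "coord (r *\<^sub>R x) i = r * coord x i"
  by (transfer, simp)+

instantiation fseq :: real_inner
begin

definition inner_fseq :: "fseq \<Rightarrow> fseq \<Rightarrow> real" where
  "inner_fseq x y = (\<Sum>i | coord x i \<noteq> 0. coord x i * coord y i)"

definition norm_fseq :: "fseq \<Rightarrow> real" where
  "norm_fseq x = sqrt (x \<bullet> x)"

definition dist_fseq :: "fseq \<Rightarrow> fseq \<Rightarrow> real" where
  "dist_fseq x y = norm (x - y)"

definition sgn_fseq :: "fseq \<Rightarrow> fseq" where
  "sgn_fseq x = x /\<^sub>R norm x"

definition uniformity_fseq :: "(fseq \<times> fseq) filter" where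
  "uniformity_fseq = (INF e\<in>{0<..}. principal {(x, y). dist x y < e})"

definition open_fseq :: "fseq set \<Rightarrow> bool" where
  "open_fseq U \<longleftrightarrow> (\<forall>x\<in>U. \<forall>\<^sub>F (x', y) in uniformity. x' = x \<longrightarrow> y \<in> U)"

lemma inner_fseq_superset:
  assumes "finite A" "{i. coord x i \<noteq> 0} \<subseteq> A"
  shows "x \<bullet> y = (\<Sum>i\<in>A. coord x i * coord y i)"
  unfolding inner_fseq_def by (rule sum.mono_neutral_left) (use assms in auto)

instance
proof
  fix x y z :: fseq and r :: real
  let ?A = "{i. coord x i \<noteq> 0} \<union> {i. coord y i \<noteq> 0}"
  have fin: "finite ?A"
    by (simp add: finite_support)
  have x: "x \<bullet> w = (\<Sum>i\<in>?A. coord x i * coord w i)" for w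
    by (rule inner_fseq_superset[OF fin]) auto
  have y: "y \<bullet> w = (\<Sum>i\<in>?A. coord y i * coord w i)" for w
    by (rule inner_fseq_superset[OF fin]) auto
  have xy: "(x + y) \<bullet> w = (\<Sum>i\<in>?A. coord (x + y) i * coord w i)" for w
    by (rule inner_fseq_superset[OF fin]) auto
  have rx: "(r *\<^sub>R x) \<bullet> w = (\<Sum>i\<in>?A. coord (r *\<^sub>R x) i * coord w i)" for w
    by (rule inner_fseq_superset[OF fin]) auto
  show "x \<bullet> y = y \<bullet> x"
    by (simp add: x y mult.commute)
  show "(x + y) \<bullet> z = x \<bullet> z + y \<bullet> z"
    by (simp add: xy x y sum.distrib algebra_simps)
  show "(r *\<^sub>R x) \<bullet> y = r * (x \<bullet> y)"
    by (simp add: rx x sum_distrib_left algebra_simps)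
  show "0 \<le> x \<bullet> x"
    unfolding inner_fseq_def by (simp add: sum_nonneg)
  show "x \<bullet> x = 0 \<longleftrightarrow> x = 0"
  proof
    assume "x \<bullet> x = 0"
    then have "\<forall>i\<in>{i. coord x i \<noteq> 0}. coord x i * coord x i = 0"
      unfolding inner_fseq_def by (subst (asm) sum_nonneg_eq_0_iff) (auto simp: finite_support)
    then have "coord x i = 0" for i
      by auto
    then show "x = 0"
      by (intro fseq_eqI) simp
  qed (simp add: inner_fseq_def)
qed (simp_all add: norm_fseq_def dist_fseq_def sgn_fseq_def uniformity_fseq_def open_fseq_def)

end

definition Rn :: "nat \<Rightarrow> fseq set" where
  "Rn n = {x. \<forall>i\<ge>n. coord x i = 0}"

lemma subspace_Rn: "subspace (Rn n)"
  by (auto simp: subspace_def Rn_def)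

lemma ex_Rn: "\<exists>x\<in>Rn n. \<forall>i<n. coord x i = a i"
proof -
  have "finite {i. (if i < n then a i else 0) \<noteq> (0::real)}"
    by (rule finite_subset[of _ "{..<n}"]) auto
  then have "coord (Abs_fseq (\<lambda>i. if i < n then a i else 0)) = (\<lambda>i. if i < n then a i else 0)"
    by (simp add: Abs_fseq_inverse)
  then show ?thesis
    by (intro bexI[of _ "Abs_fseq (\<lambda>i. if i < n then a i else 0)"]) (auto simp: Rn_def)
qed

lemma inner_Rn: "x \<in> Rn n \<Longrightarrow> x \<bullet> y = (\<Sum>i<n. coord x i * coord y i)"
  by (rule inner_fseq_superset) (auto simp: Rn_def not_le[symmetric])

lemma norm_Rn: "x \<in> Rn n \<Longrightarrow> norm x = L2_set (coord x) {..<n}"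
  by (simp add: norm_eq_sqrt_inner inner_Rn L2_set_def power2_eq_square)

text \<open>
  This repeats \<open>closest_point\<close>, whose library version is restricted to Heine-Borel spaces.
\<close>

definition Pr :: "fseq set \<Rightarrow> fseq \<Rightarrow> fseq" where
  "Pr Q a = (SOME x. x \<in> Q \<and> (\<forall>y\<in>Q. dist a x \<le> dist a y))"

definition subgradients :: "nat \<Rightarrow> fseq set \<Rightarrow> (fseq \<Rightarrow> real) \<Rightarrow> fseq \<Rightarrow> fseq set" where
  "subgradients n Q f x = {g \<in> Rn n. \<forall>y\<in>Q. f y \<ge> f x + g \<bullet> (y - x)}"

text \<open>
  Subgradients are assumed to exist at every point of \<open>Q\<close>. Without this the inequality would be
  vacuous at points with no subgradient, and \<open>f\<close> need not even be convex.
\<close>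

definition strongly_convex :: "nat \<Rightarrow> fseq set \<Rightarrow> real \<Rightarrow> (fseq \<Rightarrow> real) \<Rightarrow> bool" where
  "strongly_convex n Q \<mu> f \<longleftrightarrow>
     (\<forall>x\<in>Q. subgradients n Q f x \<noteq> {}) \<and>
     (\<forall>x\<in>Q. \<forall>g\<in>subgradients n Q f x. \<forall>y\<in>Q.
        f y \<ge> f x + g \<bullet> (y - x) + \<mu> / 2 * (norm (y - x))\<^sup>2)"

text \<open>
  \<open>g k\<close> is the subgradient \<open>\<nabla>f(x\<^sub>k)\<close> used in step \<open>k\<close>. It is an arbitrary element of the
  subdifferential, chosen anew in each step. The index \<open>0\<close> is not used.
\<close>

definition subgradient_method ::
    "nat \<Rightarrow> fseq set \<Rightarrow> real \<Rightarrow> (fseq \<Rightarrow> real) \<Rightarrow> (nat \<Rightarrow> fseq) \<Rightarrow> (nat \<Rightarrow> fseq) \<Rightarrow> bool" where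
  "subgradient_method n Q \<mu> f x g \<longleftrightarrow>
     x 1 \<in> Q \<and>
     (\<forall>k\<ge>1. g k \<in> subgradients n Q f (x k) \<and>
             x (k + 1) = Pr Q (x k - (2 / (\<mu> * (real k + 1))) *\<^sub>R g k))"

definition xhat :: "(nat \<Rightarrow> fseq) \<Rightarrow> nat \<Rightarrow> fseq" where
  "xhat x N = (\<Sum>k=1..N. (2 * real k / (real N * (real N + 1))) *\<^sub>R x k)"

end

theory Submission
  imports Defs
begin

text \<open>
  Write \<open>D k = (norm (x k - xstar))\<^sup>2\<close>. The projection onto a convex set does not increase the distance
  to the points of that set, so \<open>D (k + 1)\<close> is at most the squared distance of the unprojected step
  to \<open>xstar\<close>. Expanding that square and bounding the cross term by strong convexity gives a
  recursion for \<open>f (x k) - f xstar\<close> in terms of \<open>D k\<close>, \<open>D (k + 1)\<close> and \<open>(norm (g k))\<^sup>2\<close>. With the step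
  size \<open>2 / (\<mu> (k + 1))\<close>, and after multiplication by \<open>k\<close>, the distances enter as
  \<open>\<mu> / 4 * ((k - 1) k D k - k (k + 1) D (k + 1))\<close>
  (\<open>subgradient_step_weighted\<close>). This telescopes, and the weight \<open>(k - 1) k\<close> vanishes at \<open>k = 1\<close>, so
  that no initial distance survives in the sum. Jensen's inequality moves the bound to the
  averaged point \<open>xhat x N\<close> (\<open>subgradient_method_rate\<close>).

  If the subgradients are bounded by \<open>M\<close>, each summand on the right is at most \<open>M\<^sup>2\<close>, and the bound
  becomes \<open>2 M\<^sup>2 / (\<mu> (N + 1))\<close>. Hence \<open>C = 2\<close> is an admissible absolute constant.

  It remains to see that the projection exists at all, since the ambient space is not complete. A
  bounded part of \<open>Rn n\<close> lies in the continuous image of a cube, which is compact by Tychonoff's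
  theorem (\<open>compact_bounded_Rn\<close>), so the distance to a point attains its minimum on a closed
  subset of \<open>Rn n\<close>.
\<close>

section \<open>Projection onto closed subsets of \<open>Rn n\<close>\<close>

lemma abs_coord_le_norm: "x \<in> Rn n \<Longrightarrow> \<bar>coord x i\<bar> \<le> norm x"
proof (cases "i < n")
  case True
  assume "x \<in> Rn n"
  have "\<bar>coord x i\<bar> = L2_set (coord x) {i}"
    by simp
  also have "\<dots> \<le> L2_set (coord x) {..<n}"
    unfolding L2_set_def using True
    by (intro real_sqrt_le_mono sum_mono2) auto
  finally show ?thesis
    using \<open>x \<in> Rn n\<close> by (simp add: norm_Rn)
qed (simp add: Rn_def)

lemma coord_sum: "coord (\<Sum>i\<in>A. v i) j = (\<Sum>i\<in>A. coord (v i) j)"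
  by (induction A rule: infinite_finite_induct) auto

lemma compact_cube: "compact {a :: nat \<Rightarrow> real. \<forall>i. a i \<in> {-r..r}}"
proof -
  have "compactin (product_topology (\<lambda>_. euclidean) UNIV) (PiE UNIV (\<lambda>_::nat. {-r..r::real}))"
    by (subst compactin_PiE) auto
  moreover have "PiE UNIV (\<lambda>_::nat. {-r..r::real}) = {a. \<forall>i. a i \<in> {-r..r}}"
    by (auto simp: PiE_def Pi_def)
  ultimately show ?thesis
    by (simp only: euclidean_product_topology compactin_euclidean_iff)
qed

text \<open>
  The compact set that contains \<open>S\<close> is the image of a cube of coefficients under
  \<open>a \<mapsto> \<Sum>i<n. a i *\<^sub>R e i\<close>, where \<open>e i\<close> is the \<open>i\<close>-th unit vector.
\<close>

lemma compact_bounded_Rn: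
  assumes "S \<subseteq> Rn n" "closed S" "bounded S"
  shows "compact S"
proof -
  have "\<exists>e. \<forall>j. coord e j = (if j = i then 1 else 0)" for i
  proof -
    obtain e where "e \<in> Rn (Suc i)" "\<forall>j<Suc i. coord e j = (if j = i then 1 else 0)"
      using ex_Rn[of "Suc i" "\<lambda>j. if j = i then 1 else 0"] by blast
    then have "coord e j = (if j = i then 1 else 0)" for j
      by (cases "j < Suc i") (auto simp: Rn_def)
    then show ?thesis
      by blast
  qed
  then obtain e where e: "\<And>i j. coord (e i) j = (if j = i then 1 else 0)"
    by metis
  obtain r where r: "\<And>x. x \<in> S \<Longrightarrow> norm x \<le> r"
    using \<open>bounded S\<close> by (auto simp: bounded_iff)
  define K where "K = {a :: nat \<Rightarrow> real. \<forall>i. a i \<in> {-r..r}}"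
  define \<Phi> where "\<Phi> a = (\<Sum>i<n. a i *\<^sub>R e i)" for a
  have "continuous_on K \<Phi>"
    unfolding \<Phi>_def
    by (intro continuous_on_sum continuous_on_scaleR continuous_on_const
        continuous_on_product_coordinates[THEN continuous_on_subset]) auto
  then have "compact (\<Phi> ` K)"
    unfolding K_def by (rule compact_continuous_image[OF _ compact_cube])
  moreover have "S \<subseteq> \<Phi> ` K"
  proof
    fix x assume "x \<in> S"
    then have x: "x \<in> Rn n"
      using assms(1) by blast
    have "x = \<Phi> (coord x)"
      using x by (intro fseq_eqI) (auto simp: \<Phi>_def coord_sum e Rn_def if_distrib cong: if_cong)
    moreover have "\<bar>coord x i\<bar> \<le> r" for i
      using abs_coord_le_norm[OF x] r[OF \<open>x \<in> S\<close>] by (rule order_trans)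
    then have "coord x \<in> K"
      by (simp add: K_def abs_le_iff minus_le_iff)
    ultimately show "x \<in> \<Phi> ` K"
      by blast
  qed
  ultimately show ?thesis
    using \<open>closed S\<close> by (metis compact_Int_closed inf.absorb2)
qed

lemma Pr_closest:
  assumes "Q \<subseteq> Rn n" "closed Q" "Q \<noteq> {}"
  shows "Pr Q a \<in> Q" and "\<forall>y\<in>Q. dist a (Pr Q a) \<le> dist a y"
proof -
  obtain q where q: "q \<in> Q"
    using assms by blast
  let ?S = "Q \<inter> cball a (dist a q)"
  have "compact ?S"
    using assms by (intro compact_bounded_Rn) (auto intro: bounded_subset)
  then obtain p where p: "p \<in> ?S" "\<forall>y\<in>?S. dist a p \<le> dist a y"
    using q continuous_attains_inf[of ?S "dist a"]
    by (force intro: continuous_intros)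
  have "dist a p \<le> dist a y" if "y \<in> Q" for y
    using that p by (cases "dist a y \<le> dist a q") auto
  with p(1) have "\<exists>p. p \<in> Q \<and> (\<forall>y\<in>Q. dist a p \<le> dist a y)"
    by blast
  then have "Pr Q a \<in> Q \<and> (\<forall>y\<in>Q. dist a (Pr Q a) \<le> dist a y)"
    unfolding Pr_def by (rule someI_ex)
  then show "Pr Q a \<in> Q" "\<forall>y\<in>Q. dist a (Pr Q a) \<le> dist a y"
    by auto
qed

text \<open>
  The angle at the closest point between \<open>a\<close> and any \<open>u\<close> in \<open>Q\<close> is not acute, so in
  \<open>a - u = (a - Pr Q a) + (Pr Q a - u)\<close> the cross term of the squared norm is nonnegative.
\<close>

lemma norm_Pr_diff_le:
  assumes "Q \<subseteq> Rn n" "closed Q" "convex Q" "u \<in> Q"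
  shows "(norm (Pr Q a - u))\<^sup>2 \<le> (norm (a - u))\<^sup>2"
proof -
  let ?p = "Pr Q a"
  have p: "?p \<in> Q" "\<forall>y\<in>Q. dist a ?p \<le> dist a y"
    using Pr_closest[OF assms(1,2)] assms(4) by blast+
  have "(a - ?p) \<bullet> (u - ?p) \<le> 0"
    using any_closest_point_dot[OF assms(3,2) p(1) assms(4) p(2)] .
  moreover have "(norm (a - u))\<^sup>2 =
      (norm (a - ?p))\<^sup>2 - 2 * ((a - ?p) \<bullet> (u - ?p)) + (norm (?p - u))\<^sup>2"
    by (simp add: power2_norm_eq_inner inner_diff_left inner_diff_right inner_commute)
  ultimately show ?thesis
    using zero_le_power2[of "norm (a - ?p)"] by linarith
qed

section \<open>Convergence rate of the subgradient method\<close>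

lemma strongly_convexD:
  assumes "strongly_convex n Q \<mu> f" "g \<in> subgradients n Q f x" "x \<in> Q" "y \<in> Q"
  shows "f x + g \<bullet> (y - x) + \<mu> / 2 * (norm (y - x))\<^sup>2 \<le> f y"
  using assms by (auto simp: strongly_convex_def)

text \<open>
  A subgradient at the averaged point supports \<open>f\<close> from below. Averaging the supporting inequality
  over the points \<open>y i\<close> cancels the linear term.
\<close>

lemma Jensen_subgradient:
  assumes "strongly_convex n Q \<mu> f" "convex Q" "finite I"
    and w: "(\<Sum>i\<in>I. w i) = 1" "\<And>i. i \<in> I \<Longrightarrow> 0 \<le> w i"
    and y: "\<And>i. i \<in> I \<Longrightarrow> y i \<in> Q"
  shows "f (\<Sum>i\<in>I. w i *\<^sub>R y i) \<le> (\<Sum>i\<in>I. w i * f (y i))"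
proof -
  define z where "z = (\<Sum>i\<in>I. w i *\<^sub>R y i)"
  have "z \<in> Q"
    unfolding z_def using assms by (intro convex_sum) auto
  then obtain s where "s \<in> subgradients n Q f z"
    using assms(1) unfolding strongly_convex_def by blast
  then have s: "f z + s \<bullet> (v - z) \<le> f v" if "v \<in> Q" for v
    using that by (simp add: subgradients_def)
  have "(\<Sum>i\<in>I. w i * (f z + s \<bullet> (y i - z)))
      = (\<Sum>i\<in>I. w i) * (f z - s \<bullet> z) + s \<bullet> (\<Sum>i\<in>I. w i *\<^sub>R y i)"
    by (simp add: algebra_simps inner_diff_right inner_sum_right sum.distrib sum_subtractf
        sum_distrib_left sum_distrib_right)
  then have "f z = (\<Sum>i\<in>I. w i * (f z + s \<bullet> (y i - z)))"
    using w(1) by (simp add: z_def[symmetric])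
  also have "\<dots> \<le> (\<Sum>i\<in>I. w i * f (y i))"
    by (intro sum_mono mult_left_mono s y w)
  finally show ?thesis
    by (simp add: z_def)
qed

text \<open>
  For a step size \<open>h\<close> the recursion reads
  \<open>f x - f u \<le> (D - D') / (2 h) + h / 2 * (norm g)\<^sup>2 - \<mu> / 2 * D\<close>, with \<open>D\<close> and \<open>D'\<close> the squared
  distances to \<open>u\<close> before and after the step. For \<open>h = 2 / (\<mu> (k + 1))\<close> the coefficient of \<open>D\<close> is
  \<open>\<mu> / 4 * (k - 1)\<close> and that of \<open>D'\<close> is \<open>- \<mu> / 4 * (k + 1)\<close>. The factor \<open>k\<close> is what makes the
  coefficients of consecutive steps match.
\<close>

lemma subgradient_step_weighted:
  fixes k :: nat
  assumes "Q \<subseteq> Rn n" "convex Q" "closed Q" "\<mu> > 0" "strongly_convex n Q \<mu> f"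
    and "x \<in> Q" "u \<in> Q" and g: "g \<in> subgradients n Q f x"
  shows "real k * (f x - f u) \<le>
    \<mu> / 4 * ((real k - 1) * real k * (norm (x - u))\<^sup>2
      - real k * (real k + 1) * (norm (Pr Q (x - (2 / (\<mu> * (real k + 1))) *\<^sub>R g) - u))\<^sup>2)
    + real k * (norm g)\<^sup>2 / (real k + 1) / \<mu>"
proof -
  define h where "h = 2 / (\<mu> * (real k + 1))"
  define D where "D = (norm (x - u))\<^sup>2"
  define D' where "D' = (norm (Pr Q (x - h *\<^sub>R g) - u))\<^sup>2"
  have h: "h * (\<mu> * (real k + 1)) = 2"
    using \<open>\<mu> > 0\<close> by (simp add: h_def)
  have "D' \<le> (norm (x - h *\<^sub>R g - u))\<^sup>2"
    unfolding D'_def using assms by (intro norm_Pr_diff_le)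
  also have "\<dots> = D - 2 * h * (g \<bullet> (x - u)) + h\<^sup>2 * (norm g)\<^sup>2"
    unfolding D_def power2_norm_eq_inner
    by (simp add: inner_diff_left inner_diff_right inner_commute power2_eq_square right_diff_distrib)
  finally have D': "D' \<le> D - 2 * h * (g \<bullet> (x - u)) + h\<^sup>2 * (norm g)\<^sup>2" .
  have cross: "f x - f u + \<mu> / 2 * D \<le> g \<bullet> (x - u)"
    using strongly_convexD[OF assms(5) g assms(6,7)]
    by (simp add: D_def norm_minus_commute inner_diff_right)
  define c where "c = real k * (\<mu> * (real k + 1)) / 4"
  have "0 \<le> c"
    using \<open>\<mu> > 0\<close> by (simp add: c_def)
  have ch: "c * (2 * h) = real k"
  proof -
    have "c * (2 * h) = real k * (h * (\<mu> * (real k + 1))) / 2"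
      by (simp add: c_def)
    then show ?thesis
      by (simp add: h)
  qed
  have "real k * (f x - f u + \<mu> / 2 * D) \<le> real k * (g \<bullet> (x - u))"
    using cross by (intro mult_left_mono) auto
  also have "\<dots> = c * (2 * h * (g \<bullet> (x - u)))"
    using ch by (metis mult.assoc)
  also have "\<dots> \<le> c * (D - D' + h\<^sup>2 * (norm g)\<^sup>2)"
    using D' \<open>0 \<le> c\<close> by (intro mult_left_mono) auto
  also have "\<dots> = c * (D - D') + real k * h / 2 * (norm g)\<^sup>2"
    by (simp add: ch[symmetric] power2_eq_square algebra_simps)
  also have "real k * h / 2 * (norm g)\<^sup>2 = real k * (norm g)\<^sup>2 / (real k + 1) / \<mu>"
    by (simp add: h_def)
  finally have "real k * (f x - f u) \<le>
      (c * (D - D') - real k * (\<mu> / 2 * D)) + real k * (norm g)\<^sup>2 / (real k + 1) / \<mu>"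
    by (simp only: distrib_left)
  also have "c * (D - D') - real k * (\<mu> / 2 * D) =
      \<mu> / 4 * ((real k - 1) * real k * D - real k * (real k + 1) * D')"
    by (simp add: c_def field_simps)
  finally show ?thesis
    by (simp only: D_def D'_def h_def)
qed

lemma subgradient_method_in_Q:
  assumes "Q \<subseteq> Rn n" "closed Q" "subgradient_method n Q \<mu> f x g" "k \<ge> 1"
  shows "x k \<in> Q"
  using \<open>k \<ge> 1\<close>
proof (induction k rule: dec_induct)
  case base
  then show ?case
    using assms by (simp add: subgradient_method_def)
next
  case (step k)
  then have "Q \<noteq> {}"
    by blast
  then show ?case
    using assms Pr_closest(1)[OF assms(1,2)] step by (simp add: subgradient_method_def)
qed

theorem subgradient_method_rate:
  assumes "Q \<subseteq> Rn n" "convex Q" "closed Q" "\<mu> > 0" "strongly_convex n Q \<mu> f"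
    and "u \<in> Q" and steps: "subgradient_method n Q \<mu> f x g" and "N \<ge> 1"
  shows "f (xhat x N) - f u
    \<le> 2 / (\<mu> * real N * (real N + 1)) * (\<Sum>k=1..N. real k * (norm (g k))\<^sup>2 / (real k + 1))"
proof -
  define R where "R = (\<Sum>k=1..N. real k * (norm (g k))\<^sup>2 / (real k + 1))"
  define w where "w k = 2 * real k / (real N * (real N + 1))" for k :: nat
  have xQ: "x k \<in> Q" if "k \<ge> 1" for k
    using subgradient_method_in_Q[OF assms(1,3) steps that] .
  define T where "T k = (real k - 1) * real k * (norm (x k - u))\<^sup>2" for k
  have step: "real k * (f (x k) - f u) \<le>
      \<mu> / 4 * (T k - T (Suc k)) + real k * (norm (g k))\<^sup>2 / (real k + 1) / \<mu>"
    if "k \<in> {1..N}" for k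
    using subgradient_step_weighted[OF assms(1-5) xQ \<open>u \<in> Q\<close>, of k "g k" k] that steps
    by (simp add: subgradient_method_def T_def algebra_simps)
  have "(\<Sum>k=1..N. real k * (f (x k) - f u)) \<le>
      (\<Sum>k=1..N. \<mu> / 4 * (T k - T (Suc k)) + real k * (norm (g k))\<^sup>2 / (real k + 1) / \<mu>)"
    by (intro sum_mono step)
  also have "\<dots> = \<mu> / 4 * (\<Sum>k=1..N. T k - T (Suc k)) + R / \<mu>"
    by (simp only: sum.distrib sum_distrib_left sum_divide_distrib R_def)
  also have "(\<Sum>k=1..N. T k - T (Suc k)) = T 1 - T (Suc N)"
    using sum_Suc_diff[of 1 N "\<lambda>k. - T k"] by simp
  also have "\<dots> \<le> 0"
    by (simp add: T_def)
  finally have sum_le: "(\<Sum>k=1..N. real k * (f (x k) - f u)) \<le> R / \<mu>"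
    using \<open>\<mu> > 0\<close> by (simp add: mult_left_mono)
  have w1: "(\<Sum>k=1..N. w k) = 1"
  proof -
    have "2 * (\<Sum>k=1..N. real k) = real N * (real N + 1)"
      by (induction N) (auto simp: algebra_simps)
    then show ?thesis
      using \<open>N \<ge> 1\<close> unfolding w_def
      by (simp add: sum_distrib_left[symmetric] sum_divide_distrib[symmetric])
  qed
  have "f (xhat x N) \<le> (\<Sum>k=1..N. w k * f (x k))"
    unfolding xhat_def w_def[symmetric]
    by (rule Jensen_subgradient[OF assms(5,2)]) (use w1 xQ in \<open>auto simp: w_def\<close>)
  then have "f (xhat x N) - f u \<le> (\<Sum>k=1..N. w k * f (x k)) - (\<Sum>k=1..N. w k) * f u"
    unfolding w1 by simp
  also have "\<dots> = 2 / (real N * (real N + 1)) * (\<Sum>k=1..N. real k * (f (x k) - f u))"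
    unfolding w_def
    by (simp add: sum_distrib_left sum_distrib_right sum_subtractf[symmetric] algebra_simps
        diff_divide_distrib)
  also have "\<dots> \<le> 2 / (real N * (real N + 1)) * (R / \<mu>)"
    using sum_le by (intro mult_left_mono) auto
  finally show ?thesis
    by (simp add: R_def mult_ac)
qed

lemma subgradient_method_rate_bounded:
  assumes "Q \<subseteq> Rn n" "convex Q" "closed Q" "\<mu> > 0" "strongly_convex n Q \<mu> f"
    and "u \<in> Q" and "subgradient_method n Q \<mu> f x g" and "N \<ge> 1"
    and M: "\<And>k. k \<ge> 1 \<Longrightarrow> norm (g k) \<le> M"
  shows "f (xhat x N) - f u \<le> 2 * M\<^sup>2 / (\<mu> * (real N + 1))"
proof -
  have "real k * (norm (g k))\<^sup>2 / (real k + 1) \<le> M\<^sup>2" if "k \<in> {1..N}" for k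
  proof -
    have "(norm (g k))\<^sup>2 \<le> M\<^sup>2"
      using M that by (intro power_mono) auto
    then have "real k * (norm (g k))\<^sup>2 \<le> (real k + 1) * M\<^sup>2"
      by (intro mult_mono) auto
    then show ?thesis
      by (simp add: divide_le_eq mult.commute)
  qed
  then have "(\<Sum>k=1..N. real k * (norm (g k))\<^sup>2 / (real k + 1)) \<le> real N * M\<^sup>2"
    using sum_mono[of "{1..N}" _ "\<lambda>_. M\<^sup>2"] by fastforce
  then have "f (xhat x N) - f u \<le> 2 / (\<mu> * real N * (real N + 1)) * (real N * M\<^sup>2)"
    using subgradient_method_rate[OF assms(1-8)] \<open>\<mu> > 0\<close>
    by (elim order_trans) (intro mult_left_mono; simp)
  then show ?thesis
    using \<open>N \<ge> 1\<close> by simp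
qed

theorem mainTheorem7:
  shows "(\<forall>n Q \<mu> f xstar x g.
            Q \<subseteq> Rn n \<and> convex Q \<and> closed Q \<and> \<mu> > 0 \<and> strongly_convex n Q \<mu> f \<and>
            is_arg_min f (\<lambda>y. y \<in> Q) xstar \<and> subgradient_method n Q \<mu> f x g \<longrightarrow>
            (\<forall>N\<ge>1. f (xhat x N) - f xstar
               \<le> 2 / (\<mu> * real N * (real N + 1)) *
                  (\<Sum>k=1..N. real k * (norm (g k))\<^sup>2 / (real k + 1))))
       \<and> (\<exists>C>0. \<forall>n Q \<mu> f xstar x g.
            Q \<subseteq> Rn n \<and> convex Q \<and> closed Q \<and> \<mu> > 0 \<and> strongly_convex n Q \<mu> f \<and>
            is_arg_min f (\<lambda>y. y \<in> Q) xstar \<and> subgradient_method n Q \<mu> f x g \<longrightarrow>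
            (\<forall>M>0. M-lipschitz_on Q f \<and> (\<forall>k\<ge>1. norm (g k) \<le> M) \<longrightarrow>
              (\<forall>\<epsilon>>0. \<forall>N\<ge>1. real N \<ge> C * (M\<^sup>2 / (\<mu> * \<epsilon>)) \<longrightarrow>
                (\<forall>y\<in>Q. f (xhat x N) - f y \<le> \<epsilon>))))"
proof (intro conjI exI[of _ "2::real"] allI impI ballI)
  fix n Q \<mu> f xstar x g and N :: nat
  assume "Q \<subseteq> Rn n \<and> convex Q \<and> closed Q \<and> \<mu> > 0 \<and> strongly_convex n Q \<mu> f \<and>
      is_arg_min f (\<lambda>y. y \<in> Q) xstar \<and> subgradient_method n Q \<mu> f x g" "1 \<le> N"
  then show "f (xhat x N) - f xstar \<le> 2 / (\<mu> * real N * (real N + 1)) *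
      (\<Sum>k=1..N. real k * (norm (g k))\<^sup>2 / (real k + 1))"
    using subgradient_method_rate[of Q n \<mu> f xstar x g N] by (simp add: is_arg_min_linorder)
next
  fix n Q \<mu> f xstar x g M \<epsilon> N y
  assume *: "Q \<subseteq> Rn n \<and> convex Q \<and> closed Q \<and> \<mu> > 0 \<and> strongly_convex n Q \<mu> f \<and>
      is_arg_min f (\<lambda>y. y \<in> Q) xstar \<and> subgradient_method n Q \<mu> f x g"
    and M: "M-lipschitz_on Q f \<and> (\<forall>k\<ge>1. norm (g k) \<le> M)"
    and "1 \<le> N" "y \<in> Q" "0 < \<epsilon>" and N: "2 * (M\<^sup>2 / (\<mu> * \<epsilon>)) \<le> real N"
  then have "f (xhat x N) - f y \<le> 2 * M\<^sup>2 / (\<mu> * (real N + 1))"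
    using subgradient_method_rate_bounded[of Q n \<mu> f y x g N M] by simp
  also have "\<dots> \<le> \<epsilon>"
  proof -
    have "0 < \<mu>"
      using * by blast
    then have "2 * M\<^sup>2 \<le> real N * (\<mu> * \<epsilon>)"
      using N \<open>0 < \<epsilon>\<close> by (simp add: divide_le_eq)
    also have "\<dots> \<le> (real N + 1) * (\<mu> * \<epsilon>)"
      using \<open>0 < \<mu>\<close> \<open>0 < \<epsilon>\<close> by (intro mult_right_mono) auto
    finally show ?thesis
      using \<open>0 < \<mu>\<close> by (simp add: divide_le_eq mult_ac)
  qed
  finally show "f (xhat x N) - f y \<le> \<epsilon>" .
qed simp

end
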